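(* Suppose $c_i^Tw^*+t^*\ge1-K$ for all $i\in J$ and $-d_i^Tw^*-t^*\ge1-K$ for all $i\in L$, where $K:=K(\rho,\nu)\in[0,1/2)$, and let $\bar K\in[1/2,1)$ satisfy $$\bar K-3K^2>3\rho(1+\xi)\Big(\frac43+2\nu\Big)+3\nu\Big(\frac94+2\xi\Big)+\frac12 .$$ Suppose $\|(u_k,v_k)-(u^*,v^* )\|\le\Delta$, where $$\Delta:=\frac{\frac13(\bar K-3K^2)-\rho(1+\xi)\left(\frac43+2\nu\right)-\nu\left(\frac94+2\xi\right)-\frac16}{4\sqrt{2n}\left(1+\frac23\rho\right)},$$ let $w_k:=C^Tu_k-D^Tv_k$, and let $t_k$ be a solution of $\min_{t\in\mathbb{R}} f(w_k,t)$. Then $(w_k,t_k)$ encodes a separating hyperplane for the well-classified points; in particular $$c_i^Tw_k+t_k\ge1-\bar K\quad\forall i\in J,\qquad d_i^Tw_k+t_k\le-1+\bar K\quad\forall i\in L.$$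
   Context: Data: points $c_1,\dots,c_j,d_1,\dots,d_l\in\mathbb{R}^d$ in two classes, $n=j+l$; $C\in\mathbb{R}^{j\times d}$ and $D\in\mathbb{R}^{l\times d}$ are the matrices with rows $c_i^T$ and $d_i^T$. Parameters: $\gamma=64/n$, $\mu=n/128$ (so $1-\mu\gamma=1/2$). $e$ is the all-ones vector. Data model: $\sigma_1,\sigma_2\in[1/2,1]$, $\sigma:=\min(\sigma_1,\sigma_2)$, $0<\rho<\sigma$, $\nu>0$; $e_1$ is the first standard basis vector. $J\subseteq\{1,\dots,j\}$ with $|J|=j_0\ge n/3$ indexes the "well-classified" $c$-points, which lie in the ball $B(\sigma_1e_1,\rho)$; $L\subseteq\{1,\dots,l\}$ with $|L|=l_0\ge n/3$ indexes the "well-classified" $d$-points, which lie in $B(-\sigma_2e_1,\rho)$; the remaining $n_{\mathrm{noise}}=n-j_0-l_0\le\nu n$ points (of either class) lie in $B\left(\frac{\sigma_1-\sigma_2}2e_1,\frac{\sigma_1+\sigma_2}2+\rho\right)$. Perturbed dual SVM: $(u^*,v^* )$ is the optimal solution of $$\max\ -\tfrac12\|C^Tu-D^Tv\|^2+e^Tu+e^Tv-\tfrac\mu2\|u\|^2-\tfrac\mu2\|v\|^2\quad\text{s.t. }(u,v)\in\Omega,$$ $\Omega=\{(u,v)\in\mathbb{R}^j\times\mathbb{R}^l:e^Tu=e^Tv,\ 0\le u\le\gamma e,\ 0\le v\le\gamma e\}$. Its dual is $\min_{w\in\mathbb{R}^d,t\in\mathbb{R}}f(w,t)$ with $$f(w,t)=\tfrac12\|w\|^2+\sum_{i=1}^j\psi(c_i^Tw+t)+\sum_{i=1}^l\psi(-d_i^Tw-t),$$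 $$\psi(\theta)=\begin{cases}-\frac12\mu\gamma^2+\gamma(1-\theta),&\theta\le1-\mu\gamma,\\ \frac1{2\mu}(1-\theta)^2,&1-\mu\gamma\le\theta\le1,\\0,&\theta\ge1,\end{cases}$$ and $(w^*,t^* )$ is an optimal solution of it. $(u_k,v_k)\in\mathbb{R}^j\times\mathbb{R}^l$ is an approximate dual solution (a FISTA iterate). Constants: $\delta=\frac1{\sigma-\rho}-1$, $\xi=\sqrt{(1+\delta)^2+32\nu(11+8\delta)}-1$, $K(\rho,\nu)=\frac{3(1+\xi+64\nu)}{128(\sigma-\rho)}+3\rho(1+\xi)$. Standing assumption: $\rho,\nu$ are small enough that $\frac{1+\xi+64\nu}{\sigma-\rho}\le\frac{64}3$. *)

theory Defs
  imports "HOL-Analysis.Analysis"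
begin

definition rows_matrix :: "('i::finite \<Rightarrow> real^'d) \<Rightarrow> real^'d^'i" where
  "rows_matrix p = (\<chi> i. p i)"

definition psi :: "real \<Rightarrow> real \<Rightarrow> real \<Rightarrow> real" where
  "psi \<mu> \<gamma> \<theta> =
     (if \<theta> \<le> 1 - \<mu> * \<gamma> then - (1/2) * \<mu> * \<gamma>\<^sup>2 + \<gamma> * (1 - \<theta>)
      else if \<theta> \<le> 1 then 1 / (2 * \<mu>) * (1 - \<theta>)\<^sup>2
      else 0)"

definition svm_f ::
  "real \<Rightarrow> real \<Rightarrow> ('j::finite \<Rightarrow> real^'d) \<Rightarrow> ('l::finite \<Rightarrow> real^'d) \<Rightarrow> real^'d \<Rightarrow> real \<Rightarrow> real" where
  "svm_f \<mu> \<gamma> c d w t =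
     1/2 * (norm w)\<^sup>2 + (\<Sum>i\<in>UNIV. psi \<mu> \<gamma> (c i \<bullet> w + t)) + (\<Sum>i\<in>UNIV. psi \<mu> \<gamma> (- (d i \<bullet> w) - t))"

definition svm_Omega :: "real \<Rightarrow> ((real^'j::finite) \<times> (real^'l::finite)) set" where
  "svm_Omega \<gamma> = {(u, v). (\<Sum>i\<in>UNIV. u $ i) = (\<Sum>i\<in>UNIV. v $ i) \<and>
     (\<forall>i. 0 \<le> u $ i \<and> u $ i \<le> \<gamma>) \<and> (\<forall>i. 0 \<le> v $ i \<and> v $ i \<le> \<gamma>)}"

definition svm_w ::
  "('j::finite \<Rightarrow> real^'d) \<Rightarrow> ('l::finite \<Rightarrow> real^'d) \<Rightarrow> real^'j \<Rightarrow> real^'l \<Rightarrow> real^'d" where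
  "svm_w c d u v = transpose (rows_matrix c) *v u - transpose (rows_matrix d) *v v"

definition svm_dual_objective ::
  "real \<Rightarrow> ('j::finite \<Rightarrow> real^'d) \<Rightarrow> ('l::finite \<Rightarrow> real^'d) \<Rightarrow> real^'j \<Rightarrow> real^'l \<Rightarrow> real" where
  "svm_dual_objective \<mu> c d u v =
     - (1/2) * (norm (svm_w c d u v))\<^sup>2 + (\<Sum>i\<in>UNIV. u $ i) + (\<Sum>i\<in>UNIV. v $ i)
       - \<mu> / 2 * (norm u)\<^sup>2 - \<mu> / 2 * (norm v)\<^sup>2"

definition delta_const :: "real \<Rightarrow> real \<Rightarrow> real" where
  "delta_const \<sigma> \<rho> = 1 / (\<sigma> - \<rho>) - 1"

definition xi_const :: "real \<Rightarrow> real \<Rightarrow> real \<Rightarrow> real" where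
  "xi_const \<sigma> \<rho> \<nu> =
     sqrt ((1 + delta_const \<sigma> \<rho>)\<^sup>2 + 32 * \<nu> * (11 + 8 * delta_const \<sigma> \<rho>)) - 1"

definition K_const :: "real \<Rightarrow> real \<Rightarrow> real \<Rightarrow> real" where
  "K_const \<sigma> \<rho> \<nu> =
     3 * (1 + xi_const \<sigma> \<rho> \<nu> + 64 * \<nu>) / (128 * (\<sigma> - \<rho>)) + 3 * \<rho> * (1 + xi_const \<sigma> \<rho> \<nu>)"

definition Delta_const :: "nat \<Rightarrow> real \<Rightarrow> real \<Rightarrow> real \<Rightarrow> real \<Rightarrow> real \<Rightarrow> real" where
  "Delta_const n \<rho> \<nu> \<xi> K Kbar =
     (1/3 * (Kbar - 3 * K\<^sup>2) - \<rho> * (1 + \<xi>) * (4/3 + 2 * \<nu>) - \<nu> * (9/4 + 2 * \<xi>) - 1/6)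
       / (4 * sqrt (2 * real n) * (1 + 2/3 * \<rho>))"

text \<open>
  The coordinates of \<^typ>\<open>real^'d\<close> carry no order, so the first basis
  vector is \<^term>\<open>axis k 1\<close> for a fixed but arbitrary coordinate \<^term>\<open>k\<close>. All balls are
  closed, which also covers the case of open balls.
\<close>

definition svm_data_model ::
  "real \<Rightarrow> real \<Rightarrow> real \<Rightarrow> real \<Rightarrow> 'd::finite \<Rightarrow> ('j::finite \<Rightarrow> real^'d) \<Rightarrow> ('l::finite \<Rightarrow> real^'d)
    \<Rightarrow> 'j set \<Rightarrow> 'l set \<Rightarrow> bool" where
  "svm_data_model \<sigma>1 \<sigma>2 \<rho> \<nu> k c d J L \<longleftrightarrow>
     (let n = real (CARD('j) + CARD('l)); e1 = axis k 1;
          noise_ball = cball (((\<sigma>1 - \<sigma>2) / 2) *\<^sub>R e1) ((\<sigma>1 + \<sigma>2) / 2 + \<rho>)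
      in \<sigma>1 \<in> {1/2..1} \<and> \<sigma>2 \<in> {1/2..1} \<and> 0 < \<rho> \<and> \<rho> < min \<sigma>1 \<sigma>2 \<and> 0 < \<nu> \<and>
         real (card J) \<ge> n / 3 \<and> real (card L) \<ge> n / 3 \<and>
         n - real (card J) - real (card L) \<le> \<nu> * n \<and>
         (\<forall>i\<in>J. c i \<in> cball (\<sigma>1 *\<^sub>R e1) \<rho>) \<and>
         (\<forall>i\<in>L. d i \<in> cball (- \<sigma>2 *\<^sub>R e1) \<rho>) \<and>
         (\<forall>i. i \<notin> J \<longrightarrow> c i \<in> noise_ball) \<and>
         (\<forall>i. i \<notin> L \<longrightarrow> d i \<in> noise_ball))"

definition separating_hyperplane :: "'a::real_inner \<Rightarrow> real \<Rightarrow> 'a set \<Rightarrow> 'a set \<Rightarrow> bool" where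
  "separating_hyperplane w t A B \<longleftrightarrow>
     w \<noteq> 0 \<and> (\<forall>x\<in>A. x \<bullet> w + t > 0) \<and> (\<forall>x\<in>B. x \<bullet> w + t < 0)"

end

theory Submission
  imports Defs
begin

text \<open>
  Since \<open>\<mu>\<gamma> = 1/2\<close> and \<open>n\<gamma> = 64\<close>, the loss \<open>\<psi>\<close> is a smoothed hinge of slope at most \<open>\<gamma>\<close>, and the
  theorem compares two values of the total loss at \<open>w\<^sub>k\<close>: the one at \<open>t\<^sub>k\<close>, which is minimal in
  \<open>t\<close>, and the one at \<open>t\<^sup>*\<close>. Write \<open>\<epsilon> = \<parallel>w\<^sub>k - w\<^sup>*\<parallel>\<close>.

  At \<open>(w\<^sup>*, t\<^sup>*)\<close> a well-classified point costs at most \<open>\<gamma>K\<^sup>2\<close>. A noise point costs at most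
  \<open>\<gamma>(3/4 + \<bar>\<theta>\<bar>)\<close> at margin \<open>\<theta>\<close>, and \<open>\<bar>\<theta>\<bar> \<le> 2(1+\<rho>)(1+\<xi>) - 1/2\<close>: all points have norm at most
  \<open>1+\<rho>\<close>, comparison with the explicit classifier \<open>(1+\<delta>)e\<^sub>1\<close> gives \<open>\<parallel>w\<^sup>*\<parallel> \<le> 1+\<xi>\<close>, and then the
  margins of one well-classified point in each class confine \<open>t\<^sup>*\<close>. Moving from \<open>w\<^sup>*\<close> to \<open>w\<^sub>k\<close>
  adds at most \<open>64(1+\<rho>)\<epsilon>\<close>, so the loss at \<open>(w\<^sub>k, t\<^sub>k)\<close> is at most
  \<open>64(K\<^sup>2 + \<nu>(1/4 + 2(1+\<rho>)(1+\<xi>)) + (1+\<rho>)\<epsilon>)\<close>.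

  Suppose that the margin of one well-classified point at \<open>(w\<^sub>k, t\<^sub>k)\<close> were below \<open>1 - Kbar\<close>. The
  whole cluster of that point has diameter at most \<open>2\<rho>\<close>, so all its margins are below
  \<open>1 - Kbar + 2\<rho>\<parallel>w\<^sub>k\<parallel>\<close>; as the cluster contains a third of the data, the loss is at least
  \<open>(64/3)(Kbar - 1/4 - 2\<rho>(1+\<xi>+\<epsilon>))\<close>. The choice of \<open>\<Delta>\<close> makes \<open>\<epsilon>\<close> so small that this contradicts
  the upper bound.

  The link between \<open>\<Delta>\<close> and \<open>\<epsilon>\<close> is strong duality. The Fenchel representation
  \<open>\<psi>(\<theta>) = max {\<alpha>(1-\<theta>) - \<mu>\<alpha>\<^sup>2/2 | 0 \<le> \<alpha> \<le> \<gamma>}\<close> yields weak duality with the explicit gap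
  \<open>\<parallel>w - (C\<^sup>Tu - D\<^sup>Tv)\<parallel>\<^sup>2/2\<close>; the maximisers \<open>\<alpha>\<close> at the primal optimum are dual feasible with gap
  zero, whence \<open>w\<^sup>* = C\<^sup>Tu\<^sup>* - D\<^sup>Tv\<^sup>*\<close> (lemma \<open>primal_optimum_eq_dual\<close>). So \<open>\<epsilon>\<close> is the norm of
  \<open>svm_w\<close> at the dual error, at most \<open>\<surd>n (1+\<rho>) \<Delta>\<close>.
\<close>

section \<open>The smoothed hinge loss as a Fenchel conjugate\<close>

text \<open>The negative derivative of \<open>psi\<close>, which is also the maximiser in its Fenchel representation.\<close>

definition psi_slope :: "real \<Rightarrow> real \<Rightarrow> real \<Rightarrow> real" where
  "psi_slope \<mu> \<gamma> \<theta> = max 0 (min \<gamma> ((1 - \<theta>) / \<mu>))"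

lemma psi_slope_bounds:
  assumes "0 \<le> \<gamma>"
  shows "0 \<le> psi_slope \<mu> \<gamma> \<theta>" "psi_slope \<mu> \<gamma> \<theta> \<le> \<gamma>"
  using assms by (auto simp: psi_slope_def)

lemma psi_slope_cases:
  assumes "0 < \<mu>" "0 \<le> \<gamma>"
  obtains (saturated) "\<theta> \<le> 1 - \<mu> * \<gamma>" "psi_slope \<mu> \<gamma> \<theta> = \<gamma>"
    | (quadratic) "1 - \<mu> * \<gamma> < \<theta>" "\<theta> \<le> 1" "psi_slope \<mu> \<gamma> \<theta> = (1 - \<theta>) / \<mu>"
    | (zero) "1 - \<mu> * \<gamma> < \<theta>" "1 < \<theta>" "psi_slope \<mu> \<gamma> \<theta> = 0"
proof -
  consider "\<theta> \<le> 1 - \<mu> * \<gamma>" | "1 - \<mu> * \<gamma> < \<theta>" "\<theta> \<le> 1" | "1 - \<mu> * \<gamma> < \<theta>" "1 < \<theta>"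
    by linarith
  then show thesis
  proof cases
    case 1
    then have "psi_slope \<mu> \<gamma> \<theta> = \<gamma>"
      using assms by (simp add: psi_slope_def field_simps)
    with 1 show thesis
      by (rule saturated)
  next
    case 2
    then have "psi_slope \<mu> \<gamma> \<theta> = (1 - \<theta>) / \<mu>"
      using assms by (simp add: psi_slope_def field_simps)
    with 2 show thesis
      by (rule quadratic)
  next
    case 3
    have "(1 - \<theta>) / \<mu> \<le> 0"
      using 3 assms by (simp add: divide_nonpos_pos)
    then have "psi_slope \<mu> \<gamma> \<theta> = 0"
      by (simp add: psi_slope_def)
    with 3 show thesis
      by (rule zero)
  qed
qed

lemma psi_eq_slope:
  assumes "0 < \<mu>" "0 \<le> \<gamma>"
  shows "psi \<mu> \<gamma> \<theta> = psi_slope \<mu> \<gamma> \<theta> * (1 - \<theta>) - \<mu> / 2 * (psi_slope \<mu> \<gamma> \<theta>)\<^sup>2"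
  using assms
  by (cases rule: psi_slope_cases[OF assms, of \<theta>]) (auto simp: psi_def power2_eq_square)

text \<open>
  The concave quadratic \<open>\<alpha> \<mapsto> \<alpha>(1-\<theta>) - \<mu>\<alpha>\<^sup>2/2\<close> is maximal on \<open>[0,\<gamma>]\<close> at the slope, and having
  curvature \<open>\<mu>\<close> it drops at least quadratically away from there. The extra term is what makes the
  conjugate \<open>psi\<close> smooth.
\<close>

lemma psi_ge_strong:
  assumes "0 < \<mu>" "0 \<le> \<alpha>" "\<alpha> \<le> \<gamma>"
  shows "\<alpha> * (1 - \<theta>) - \<mu> / 2 * \<alpha>\<^sup>2 + \<mu> / 2 * (\<alpha> - psi_slope \<mu> \<gamma> \<theta>)\<^sup>2 \<le> psi \<mu> \<gamma> \<theta>"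
proof -
  define a where "a = psi_slope \<mu> \<gamma> \<theta>"
  have "(a - \<alpha>) * (1 - \<theta> - \<mu> * a) \<ge> 0"
  proof -
    have "0 \<le> \<gamma>"
      using assms by linarith
    then show ?thesis
      using assms
      by (cases rule: psi_slope_cases[OF assms(1), of \<gamma> \<theta>]) (auto simp: a_def mult_nonneg_nonpos)
  qed
  then show ?thesis
    using psi_eq_slope[of \<mu> \<gamma> \<theta>] assms
    by (simp add: a_def[symmetric] power2_eq_square algebra_simps)
qed

lemma psi_ge:
  assumes "0 < \<mu>" "0 \<le> \<alpha>" "\<alpha> \<le> \<gamma>"
  shows "\<alpha> * (1 - \<theta>) - \<mu> / 2 * \<alpha>\<^sup>2 \<le> psi \<mu> \<gamma> \<theta>"
proof -
  have "0 \<le> \<mu> / 2 * (\<alpha> - psi_slope \<mu> \<gamma> \<theta>)\<^sup>2"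
    using assms by simp
  then show ?thesis
    using psi_ge_strong[OF assms, of \<theta>] by linarith
qed

lemma psi_nonneg:
  assumes "0 < \<mu>" "0 \<le> \<gamma>"
  shows "0 \<le> psi \<mu> \<gamma> \<theta>"
  using psi_ge[of \<mu> 0 \<gamma> \<theta>] assms by simp

text \<open>
  The descent lemma for \<open>psi\<close>: insert the slope at \<open>\<theta>'\<close> into the representation at \<open>\<theta>\<close> and absorb
  the change of slope by the strong concavity term.
\<close>

lemma psi_quadratic_upper:
  assumes "0 < \<mu>" "0 \<le> \<gamma>"
  shows "psi \<mu> \<gamma> \<theta>' \<le> psi \<mu> \<gamma> \<theta> - psi_slope \<mu> \<gamma> \<theta> * (\<theta>' - \<theta>) + (\<theta>' - \<theta>)\<^sup>2 / (2 * \<mu>)"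
proof -
  define a where "a = psi_slope \<mu> \<gamma> \<theta>"
  define a' where "a' = psi_slope \<mu> \<gamma> \<theta>'"
  have "a' * (1 - \<theta>) - \<mu> / 2 * a'\<^sup>2 + \<mu> / 2 * (a' - a)\<^sup>2 \<le> psi \<mu> \<gamma> \<theta>"
    unfolding a_def a'_def using assms by (intro psi_ge_strong psi_slope_bounds)
  moreover have "psi \<mu> \<gamma> \<theta>' = a' * (1 - \<theta>') - \<mu> / 2 * a'\<^sup>2"
    unfolding a'_def by (rule psi_eq_slope[OF assms])
  moreover have "(\<theta>' - \<theta>)\<^sup>2 / (2 * \<mu>) + (a' - a) * (\<theta>' - \<theta>) + \<mu> / 2 * (a' - a)\<^sup>2
      = ((\<theta>' - \<theta>) + \<mu> * (a' - a))\<^sup>2 / (2 * \<mu>)"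
    using assms by (simp add: field_simps power2_eq_square)
  moreover have "0 \<le> ((\<theta>' - \<theta>) + \<mu> * (a' - a))\<^sup>2 / (2 * \<mu>)"
    using assms by simp
  ultimately show ?thesis
    unfolding a_def[symmetric] by (simp add: algebra_simps)
qed

lemma psi_diff_le:
  assumes "0 < \<mu>" "0 \<le> \<gamma>"
  shows "psi \<mu> \<gamma> \<theta>' \<le> psi \<mu> \<gamma> \<theta> + psi_slope \<mu> \<gamma> \<theta>' * (\<theta> - \<theta>')"
  using psi_ge[OF assms(1) psi_slope_bounds[OF assms(2)], of \<mu> \<theta>' \<theta>] psi_eq_slope[OF assms, of \<theta>']
  by (simp add: algebra_simps)

lemma psi_antimono:
  assumes "0 < \<mu>" "0 \<le> \<gamma>" "\<theta> \<le> \<theta>'"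
  shows "psi \<mu> \<gamma> \<theta>' \<le> psi \<mu> \<gamma> \<theta>"
proof -
  have "psi_slope \<mu> \<gamma> \<theta>' * (\<theta> - \<theta>') \<le> 0"
    using assms psi_slope_bounds(1)[of \<gamma> \<mu> \<theta>'] by (simp add: mult_nonneg_nonpos)
  then show ?thesis
    using psi_diff_le[OF assms(1,2), of \<theta>' \<theta>] by linarith
qed

lemma psi_lipschitz:
  assumes "0 < \<mu>" "0 \<le> \<gamma>"
  shows "psi \<mu> \<gamma> \<theta>' \<le> psi \<mu> \<gamma> \<theta> + \<gamma> * \<bar>\<theta>' - \<theta>\<bar>"
proof -
  have "psi_slope \<mu> \<gamma> \<theta>' * (\<theta> - \<theta>') \<le> psi_slope \<mu> \<gamma> \<theta>' * \<bar>\<theta>' - \<theta>\<bar>"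
    using psi_slope_bounds(1)[OF assms(2)] by (intro mult_left_mono) auto
  also have "\<dots> \<le> \<gamma> * \<bar>\<theta>' - \<theta>\<bar>"
    using psi_slope_bounds(2)[OF assms(2)] by (intro mult_right_mono) auto
  finally show ?thesis
    using psi_diff_le[OF assms, of \<theta>' \<theta>] by linarith
qed

lemma psi_le_quadratic:
  assumes "0 < \<mu>" "0 \<le> \<gamma>" "0 \<le> K" "1 - K \<le> \<theta>"
  shows "psi \<mu> \<gamma> \<theta> \<le> K\<^sup>2 / (2 * \<mu>)"
proof -
  have "psi_slope \<mu> \<gamma> 1 = 0"
    using assms by (simp add: psi_slope_def)
  moreover from this have "psi \<mu> \<gamma> 1 = 0"
    using psi_eq_slope[OF assms(1,2), of 1] by simp
  ultimately have "psi \<mu> \<gamma> (1 - K) \<le> K\<^sup>2 / (2 * \<mu>)"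
    using psi_quadratic_upper[OF assms(1,2), of "1 - K" 1] by simp
  then show ?thesis
    using psi_antimono[OF assms(1,2,4)] by linarith
qed

section \<open>Strong duality\<close>

lemma svm_w_eq_sum:
  "svm_w c d u v = (\<Sum>i\<in>UNIV. u $ i *\<^sub>R c i) - (\<Sum>i\<in>UNIV. v $ i *\<^sub>R d i)"
  by (simp add: svm_w_def rows_matrix_def transpose_def matrix_vector_mult_def vec_eq_iff
      mult.commute)

lemma svm_w_diff:
  "svm_w c d (u - u') (v - v') = svm_w c d u v - svm_w c d u' v'"
  by (simp add: svm_w_def matrix_vector_mult_diff_distrib)

lemma inner_svm_w:
  "w \<bullet> svm_w c d u v = (\<Sum>i\<in>UNIV. u $ i * (c i \<bullet> w)) - (\<Sum>i\<in>UNIV. v $ i * (d i \<bullet> w))"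
  by (simp add: svm_w_eq_sum inner_diff_right inner_sum_right inner_commute)

lemma norm_vec_squared: "(norm (u :: real^'i))\<^sup>2 = (\<Sum>i\<in>UNIV. (u $ i)\<^sup>2)"
  by (simp add: power2_norm_eq_inner inner_vec_def) (simp add: power2_eq_square)

text \<open>
  The Lagrangian, obtained from the primal objective by replacing each loss with its Fenchel
  minorant: completing the square in \<open>w\<close> leaves the dual objective. On the feasible set the term
  in \<open>t\<close> vanishes.
\<close>

lemma lagrangian_eq_dual:
  "1/2 * (norm w)\<^sup>2 + (\<Sum>i\<in>UNIV. u $ i * (1 - (c i \<bullet> w + t)) - \<mu> / 2 * (u $ i)\<^sup>2)
     + (\<Sum>i\<in>UNIV. v $ i * (1 - (- (d i \<bullet> w) - t)) - \<mu> / 2 * (v $ i)\<^sup>2)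
   = svm_dual_objective \<mu> c d u v + 1/2 * (norm (w - svm_w c d u v))\<^sup>2
     - t * ((\<Sum>i\<in>UNIV. u $ i) - (\<Sum>i\<in>UNIV. v $ i))"
proof -
  have u: "(\<Sum>i\<in>UNIV. u $ i * (1 - (c i \<bullet> w + t)) - \<mu> / 2 * (u $ i)\<^sup>2)
      = (\<Sum>i\<in>UNIV. u $ i) - (\<Sum>i\<in>UNIV. u $ i * (c i \<bullet> w)) - t * (\<Sum>i\<in>UNIV. u $ i)
        - \<mu> / 2 * (norm u)\<^sup>2"
    by (simp add: norm_vec_squared sum_distrib_left algebra_simps sum.distrib sum_subtractf)
  have v: "(\<Sum>i\<in>UNIV. v $ i * (1 - (- (d i \<bullet> w) - t)) - \<mu> / 2 * (v $ i)\<^sup>2)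
      = (\<Sum>i\<in>UNIV. v $ i) + (\<Sum>i\<in>UNIV. v $ i * (d i \<bullet> w)) + t * (\<Sum>i\<in>UNIV. v $ i)
        - \<mu> / 2 * (norm v)\<^sup>2"
    by (simp add: norm_vec_squared sum_distrib_left algebra_simps sum.distrib sum_subtractf)
  have sq: "(norm (w - svm_w c d u v))\<^sup>2
      = (norm w)\<^sup>2 + (norm (svm_w c d u v))\<^sup>2 - 2 * (w \<bullet> svm_w c d u v)"
    by (simp add: power2_norm_eq_inner inner_diff_left inner_diff_right inner_commute)
  show ?thesis
    unfolding u v sq svm_dual_objective_def inner_svm_w by (simp add: algebra_simps)
qed

lemma weak_duality_gap:
  assumes "0 < \<mu>" "(u, v) \<in> svm_Omega \<gamma>"
  shows "svm_dual_objective \<mu> c d u v + 1/2 * (norm (w - svm_w c d u v))\<^sup>2 \<le> svm_f \<mu> \<gamma> c d w t"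
proof -
  have u: "0 \<le> u $ i" "u $ i \<le> \<gamma>" for i
    using assms(2) by (auto simp: svm_Omega_def)
  have v: "0 \<le> v $ i" "v $ i \<le> \<gamma>" for i
    using assms(2) by (auto simp: svm_Omega_def)
  have "(\<Sum>i\<in>UNIV. u $ i) - (\<Sum>i\<in>UNIV. v $ i) = 0"
    using assms(2) by (simp add: svm_Omega_def)
  moreover have "1/2 * (norm w)\<^sup>2 + (\<Sum>i\<in>UNIV. u $ i * (1 - (c i \<bullet> w + t)) - \<mu> / 2 * (u $ i)\<^sup>2)
     + (\<Sum>i\<in>UNIV. v $ i * (1 - (- (d i \<bullet> w) - t)) - \<mu> / 2 * (v $ i)\<^sup>2)
     \<le> svm_f \<mu> \<gamma> c d w t"
    unfolding svm_f_def by (intro add_mono sum_mono order_refl psi_ge assms(1) u v)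
  ultimately show ?thesis
    unfolding lagrangian_eq_dual by simp
qed

lemma linear_coefficient_zero:
  fixes A B :: real
  assumes "\<And>s. 0 \<le> s * A + s\<^sup>2 * B"
  shows "A = 0"
proof (rule ccontr)
  assume "A \<noteq> 0"
  define M where "M = \<bar>B\<bar> + 1"
  (* The minimiser of s * A + s^2 * M, where M > B is positive. *)
  define s where "s = - A / (2 * M)"
  have M: "0 < M" "B \<le> M"
    by (auto simp: M_def)
  have "0 \<le> s * A + s\<^sup>2 * B"
    by (rule assms)
  also have "\<dots> \<le> s * A + s\<^sup>2 * M"
    using M by (simp add: mult_left_mono)
  also have "\<dots> = - (A\<^sup>2 / (4 * M))"
    using M by (simp add: s_def field_simps power2_eq_square)
  also have "\<dots> < 0"
    using \<open>A \<noteq> 0\<close> M by simp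
  finally show False
    by simp
qed

text \<open>
  First-order optimality. Along a line \<open>(w + s x, t + s \<tau>)\<close> the descent lemma bounds the
  objective by a quadratic in \<open>s\<close> with the expected linear coefficient, which must vanish at a
  minimum. The bound holds uniformly across the break points of \<open>psi\<close>.
\<close>

lemma svm_f_stationary:
  assumes "0 < \<mu>" "0 \<le> \<gamma>"
    and min: "\<And>w' t'. svm_f \<mu> \<gamma> c d w t \<le> svm_f \<mu> \<gamma> c d w' t'"
    and u: "u = (\<chi> i. psi_slope \<mu> \<gamma> (c i \<bullet> w + t))"
    and v: "v = (\<chi> i. psi_slope \<mu> \<gamma> (- (d i \<bullet> w) - t))"
  shows "w = svm_w c d u v" and "(\<Sum>i\<in>UNIV. u $ i) = (\<Sum>i\<in>UNIV. v $ i)"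
proof -
  have line: "(w - svm_w c d u v) \<bullet> x - \<tau> * ((\<Sum>i\<in>UNIV. u $ i) - (\<Sum>i\<in>UNIV. v $ i)) = 0"
    (is "?A = 0") for x \<tau>
  proof -
    define B where "B = 1/2 * (norm x)\<^sup>2 + (\<Sum>i\<in>UNIV. (c i \<bullet> x + \<tau>)\<^sup>2 / (2 * \<mu>))
        + (\<Sum>i\<in>UNIV. (d i \<bullet> x + \<tau>)\<^sup>2 / (2 * \<mu>))"
    have "0 \<le> s * ?A + s\<^sup>2 * B" for s
    proof -
      have c: "psi \<mu> \<gamma> (c i \<bullet> (w + s *\<^sub>R x) + (t + s * \<tau>))
          \<le> psi \<mu> \<gamma> (c i \<bullet> w + t) - s * (u $ i * (c i \<bullet> x + \<tau>))
            + s\<^sup>2 * ((c i \<bullet> x + \<tau>)\<^sup>2 / (2 * \<mu>))" for i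
      proof -
        have "c i \<bullet> (w + s *\<^sub>R x) + (t + s * \<tau>) - (c i \<bullet> w + t) = s * (c i \<bullet> x + \<tau>)"
          by (simp add: inner_add_right algebra_simps)
        then show ?thesis
          using psi_quadratic_upper[OF assms(1,2),
              of "c i \<bullet> (w + s *\<^sub>R x) + (t + s * \<tau>)" "c i \<bullet> w + t"]
          by (simp add: u power_mult_distrib mult.left_commute)
      qed
      have d: "psi \<mu> \<gamma> (- (d i \<bullet> (w + s *\<^sub>R x)) - (t + s * \<tau>))
          \<le> psi \<mu> \<gamma> (- (d i \<bullet> w) - t) + s * (v $ i * (d i \<bullet> x + \<tau>))
            + s\<^sup>2 * ((d i \<bullet> x + \<tau>)\<^sup>2 / (2 * \<mu>))" for i
      proof -
        have "- (d i \<bullet> (w + s *\<^sub>R x)) - (t + s * \<tau>) - (- (d i \<bullet> w) - t)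
            = - (s * (d i \<bullet> x + \<tau>))"
          by (simp add: inner_add_right algebra_simps)
        then show ?thesis
          using psi_quadratic_upper[OF assms(1,2),
              of "- (d i \<bullet> (w + s *\<^sub>R x)) - (t + s * \<tau>)" "- (d i \<bullet> w) - t"]
          by (simp add: v power_mult_distrib mult.left_commute)
      qed
      have "svm_f \<mu> \<gamma> c d w t \<le> svm_f \<mu> \<gamma> c d (w + s *\<^sub>R x) (t + s * \<tau>)"
        by (rule min)
      also have "\<dots> \<le> 1/2 * (norm (w + s *\<^sub>R x))\<^sup>2
          + (\<Sum>i\<in>UNIV. psi \<mu> \<gamma> (c i \<bullet> w + t) - s * (u $ i * (c i \<bullet> x + \<tau>))
            + s\<^sup>2 * ((c i \<bullet> x + \<tau>)\<^sup>2 / (2 * \<mu>)))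
          + (\<Sum>i\<in>UNIV. psi \<mu> \<gamma> (- (d i \<bullet> w) - t) + s * (v $ i * (d i \<bullet> x + \<tau>))
            + s\<^sup>2 * ((d i \<bullet> x + \<tau>)\<^sup>2 / (2 * \<mu>)))"
        unfolding svm_f_def by (intro add_mono sum_mono order_refl c d)
      also have "\<dots> = svm_f \<mu> \<gamma> c d w t + s * (w \<bullet> x)
          - s * (\<Sum>i\<in>UNIV. u $ i * (c i \<bullet> x + \<tau>)) + s * (\<Sum>i\<in>UNIV. v $ i * (d i \<bullet> x + \<tau>))
          + s\<^sup>2 * B"
      proof -
        have "(norm (w + s *\<^sub>R x))\<^sup>2 = (norm w)\<^sup>2 + 2 * s * (w \<bullet> x) + s\<^sup>2 * (norm x)\<^sup>2"
          unfolding power2_norm_eq_inner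
          by (simp add: inner_add_left inner_add_right inner_commute power2_eq_square algebra_simps)
        then show ?thesis
          unfolding svm_f_def B_def
          by (simp add: sum.distrib sum_subtractf sum_distrib_left distrib_left)
      qed
      also have "\<dots> = svm_f \<mu> \<gamma> c d w t + s * ?A + s\<^sup>2 * B"
        by (simp add: inner_diff_left inner_commute[of "svm_w c d u v"] inner_svm_w
            distrib_left sum.distrib sum_distrib_left algebra_simps)
      finally show ?thesis
        by simp
    qed
    then show ?thesis
      by (rule linear_coefficient_zero)
  qed
  show "w = svm_w c d u v"
    using line[of "w - svm_w c d u v" 0] by simp
  show "(\<Sum>i\<in>UNIV. u $ i) = (\<Sum>i\<in>UNIV. v $ i)"
    using line[of 0 1] by simp
qed

text \<open>
  The slopes at a primal optimum form a feasible dual point whose dual value is the primal value,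
  so the gap in weak duality, and with it \<open>w - svm_w c d u v\<close>, vanishes at every dual optimum.
\<close>

lemma primal_optimum_eq_dual:
  assumes "0 < \<mu>" "0 \<le> \<gamma>"
    and dual: "is_arg_max (\<lambda>(u, v). svm_dual_objective \<mu> c d u v) (\<lambda>p. p \<in> svm_Omega \<gamma>) (u, v)"
    and primal: "is_arg_min (\<lambda>(w, t). svm_f \<mu> \<gamma> c d w t) (\<lambda>_. True) (w, t)"
  shows "w = svm_w c d u v"
proof -
  have min: "svm_f \<mu> \<gamma> c d w t \<le> svm_f \<mu> \<gamma> c d w' t'" for w' t'
    using primal by (auto simp: is_arg_min_def not_less)
  define u' where "u' = (\<chi> i. psi_slope \<mu> \<gamma> (c i \<bullet> w + t))"
  define v' where "v' = (\<chi> i. psi_slope \<mu> \<gamma> (- (d i \<bullet> w) - t))"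
  have w: "w = svm_w c d u' v'" and bal: "(\<Sum>i\<in>UNIV. u' $ i) = (\<Sum>i\<in>UNIV. v' $ i)"
    using svm_f_stationary[OF assms(1,2) min u'_def v'_def] by auto
  have "svm_f \<mu> \<gamma> c d w t = 1/2 * (norm w)\<^sup>2
      + (\<Sum>i\<in>UNIV. u' $ i * (1 - (c i \<bullet> w + t)) - \<mu> / 2 * (u' $ i)\<^sup>2)
      + (\<Sum>i\<in>UNIV. v' $ i * (1 - (- (d i \<bullet> w) - t)) - \<mu> / 2 * (v' $ i)\<^sup>2)"
    by (simp add: svm_f_def u'_def v'_def psi_eq_slope[OF assms(1,2)])
  also have "\<dots> = svm_dual_objective \<mu> c d u' v'"
    unfolding lagrangian_eq_dual using w bal by simp
  also have "\<dots> \<le> svm_dual_objective \<mu> c d u v"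
  proof -
    have "(u', v') \<in> svm_Omega \<gamma>"
      using bal psi_slope_bounds[OF assms(2)] by (simp add: svm_Omega_def u'_def v'_def)
    then show ?thesis
      using dual by (auto simp: is_arg_max_def not_less)
  qed
  finally have "svm_f \<mu> \<gamma> c d w t \<le> svm_dual_objective \<mu> c d u v" .
  moreover have "(u, v) \<in> svm_Omega \<gamma>"
    using dual by (simp add: is_arg_max_def)
  ultimately have "(norm (w - svm_w c d u v))\<^sup>2 \<le> 0"
    using weak_duality_gap[OF assms(1), of u v \<gamma> c d w t] by linarith
  then show ?thesis
    by simp
qed

section \<open>Perturbation and loss bounds\<close>

lemma sum_abs_le_sqrt_card_norm:
  fixes u :: "real^'i"
  shows "(\<Sum>i\<in>UNIV. \<bar>u $ i\<bar>) \<le> sqrt (real CARD('i)) * norm u"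
proof -
  have "(\<Sum>i\<in>UNIV. \<bar>1\<bar> * \<bar>u $ i\<bar>) \<le> L2_set (\<lambda>_. 1) (UNIV :: 'i set) * L2_set (($) u) UNIV"
    by (rule L2_set_mult_ineq)
  then show ?thesis
    by (simp add: norm_vec_def L2_set_def)
qed

lemma norm_svm_w_le:
  fixes c :: "'j::finite \<Rightarrow> real^'d" and d :: "'l::finite \<Rightarrow> real^'d"
  assumes c: "\<And>i. norm (c i) \<le> R" and d: "\<And>i. norm (d i) \<le> R"
  shows "norm (svm_w c d u v) \<le> R * (sqrt (real (CARD('j) + CARD('l))) * norm (u, v))"
proof -
  have R: "0 \<le> R"
    using c norm_ge_zero order_trans by blast
  have "norm (svm_w c d u v) \<le> norm (\<Sum>i\<in>UNIV. u $ i *\<^sub>R c i) + norm (\<Sum>i\<in>UNIV. v $ i *\<^sub>R d i)"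
    unfolding svm_w_eq_sum by (rule norm_triangle_ineq4)
  also have "\<dots> \<le> (\<Sum>i\<in>UNIV. \<bar>u $ i\<bar> * R) + (\<Sum>i\<in>UNIV. \<bar>v $ i\<bar> * R)"
    by (intro add_mono sum_norm_le) (auto intro!: mult_left_mono c d)
  also have "\<dots> = R * ((\<Sum>i\<in>UNIV. \<bar>u $ i\<bar>) + (\<Sum>i\<in>UNIV. \<bar>v $ i\<bar>))"
    by (simp add: sum_distrib_left distrib_left mult.commute)
  also have "\<dots> \<le> R * (sqrt (real CARD('j)) * norm u + sqrt (real CARD('l)) * norm v)"
    using R by (intro mult_left_mono add_mono sum_abs_le_sqrt_card_norm)
  also have "\<dots> \<le> R * (sqrt (real (CARD('j) + CARD('l))) * norm (u, v))"
  proof (rule mult_left_mono[OF _ R])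
    have "(sqrt (real CARD('j)), sqrt (real CARD('l))) \<bullet> (norm u, norm v)
        \<le> norm (sqrt (real CARD('j)), sqrt (real CARD('l))) * norm (norm u, norm v)"
      by (rule norm_cauchy_schwarz)
    then show "sqrt (real CARD('j)) * norm u + sqrt (real CARD('l)) * norm v
        \<le> sqrt (real (CARD('j) + CARD('l))) * norm (u, v)"
      by (simp add: norm_Pair)
  qed
  finally show ?thesis .
qed

definition svm_loss ::
  "real \<Rightarrow> real \<Rightarrow> ('j::finite \<Rightarrow> real^'d) \<Rightarrow> ('l::finite \<Rightarrow> real^'d) \<Rightarrow> real^'d \<Rightarrow> real \<Rightarrow> real" where
  "svm_loss \<mu> \<gamma> c d w t =
     (\<Sum>i\<in>UNIV. psi \<mu> \<gamma> (c i \<bullet> w + t)) + (\<Sum>i\<in>UNIV. psi \<mu> \<gamma> (- (d i \<bullet> w) - t))"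

lemma svm_f_eq_loss: "svm_f \<mu> \<gamma> c d w t = 1/2 * (norm w)\<^sup>2 + svm_loss \<mu> \<gamma> c d w t"
  by (simp add: svm_f_def svm_loss_def)

lemma sum_le_card_split:
  fixes g :: "'i::finite \<Rightarrow> real"
  assumes "\<And>i. i \<in> S \<Longrightarrow> g i \<le> a" and "\<And>i. i \<notin> S \<Longrightarrow> g i \<le> b"
  shows "(\<Sum>i\<in>UNIV. g i) \<le> real (card S) * a + (real CARD('i) - real (card S)) * b"
proof -
  have "(\<Sum>i\<in>UNIV. g i) = (\<Sum>i\<in>S. g i) + (\<Sum>i\<in>- S. g i)"
    by (metis Compl_eq_Diff_UNIV add.commute finite_code subset_UNIV sum.subset_diff)
  also have "\<dots> \<le> real (card S) * a + real (card (- S)) * b"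
    using assms by (intro add_mono sum_bounded_above) auto
  also have "real (card (- S)) = real CARD('i) - real (card S)"
    by (simp add: Compl_eq_Diff_UNIV card_Diff_subset of_nat_diff card_mono)
  finally show ?thesis .
qed

lemma svm_loss_le_split:
  fixes c :: "'j::finite \<Rightarrow> real^'d" and d :: "'l::finite \<Rightarrow> real^'d"
  assumes n: "n = real (CARD('j) + CARD('l))"
    and noise: "n - real (card J) - real (card L) \<le> \<nu> * n"
    and "0 \<le> a" "0 \<le> b"
    and "\<And>i. i \<in> J \<Longrightarrow> psi \<mu> \<gamma> (c i \<bullet> w + t) \<le> a"
    and "\<And>i. i \<in> L \<Longrightarrow> psi \<mu> \<gamma> (- (d i \<bullet> w) - t) \<le> a"
    and "\<And>i. i \<notin> J \<Longrightarrow> psi \<mu> \<gamma> (c i \<bullet> w + t) \<le> b"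
    and "\<And>i. i \<notin> L \<Longrightarrow> psi \<mu> \<gamma> (- (d i \<bullet> w) - t) \<le> b"
  shows "svm_loss \<mu> \<gamma> c d w t \<le> n * (a + \<nu> * b)"
proof -
  have "svm_loss \<mu> \<gamma> c d w t
      \<le> (real (card J) * a + (real CARD('j) - real (card J)) * b)
        + (real (card L) * a + (real CARD('l) - real (card L)) * b)"
    unfolding svm_loss_def using assms by (intro add_mono sum_le_card_split) auto
  also have "\<dots> = (real (card J) + real (card L)) * a + (n - real (card J) - real (card L)) * b"
    by (simp add: n algebra_simps)
  also have "\<dots> \<le> n * a + (\<nu> * n) * b"
  proof (intro add_mono mult_right_mono noise assms(3,4))
    have "card J \<le> CARD('j)" "card L \<le> CARD('l)"
      by (auto intro: card_mono)
    then show "real (card J) + real (card L) \<le> n"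
      by (simp add: n)
  qed
  finally show ?thesis
    by (simp add: algebra_simps)
qed

lemma svm_loss_lipschitz:
  fixes c :: "'j::finite \<Rightarrow> real^'d" and d :: "'l::finite \<Rightarrow> real^'d"
  assumes "0 < \<mu>" "0 \<le> \<gamma>" and c: "\<And>i. norm (c i) \<le> R" and d: "\<And>i. norm (d i) \<le> R"
  shows "svm_loss \<mu> \<gamma> c d w' t
    \<le> svm_loss \<mu> \<gamma> c d w t + real (CARD('j) + CARD('l)) * \<gamma> * (R * norm (w' - w))"
proof -
  have inner_le: "\<bar>p \<bullet> w' - p \<bullet> w\<bar> \<le> R * norm (w' - w)" if "norm p \<le> R" for p :: "real^'d"
  proof -
    have "\<bar>p \<bullet> (w' - w)\<bar> \<le> norm p * norm (w' - w)"
      by (rule Cauchy_Schwarz_ineq2)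
    also have "\<dots> \<le> R * norm (w' - w)"
      using that by (simp add: mult_right_mono)
    finally show ?thesis
      by (simp add: inner_diff_right)
  qed
  have step: "psi \<mu> \<gamma> \<theta>' \<le> psi \<mu> \<gamma> \<theta> + \<gamma> * (R * norm (w' - w))"
    if "\<bar>\<theta>' - \<theta>\<bar> \<le> R * norm (w' - w)" for \<theta> \<theta>'
    using psi_lipschitz[OF assms(1,2), of \<theta>' \<theta>] mult_left_mono[OF that assms(2)] by linarith
  have "svm_loss \<mu> \<gamma> c d w' t
      \<le> (\<Sum>i\<in>UNIV. psi \<mu> \<gamma> (c i \<bullet> w + t) + \<gamma> * (R * norm (w' - w)))
        + (\<Sum>i\<in>UNIV. psi \<mu> \<gamma> (- (d i \<bullet> w) - t) + \<gamma> * (R * norm (w' - w)))"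
    unfolding svm_loss_def
  proof (intro add_mono sum_mono step)
    fix i show "\<bar>c i \<bullet> w' + t - (c i \<bullet> w + t)\<bar> \<le> R * norm (w' - w)"
      using inner_le[OF c[of i]] by simp
  next
    fix i show "\<bar>- (d i \<bullet> w') - t - (- (d i \<bullet> w) - t)\<bar> \<le> R * norm (w' - w)"
      using inner_le[OF d[of i]] by linarith
  qed
  also have "\<dots> = svm_loss \<mu> \<gamma> c d w t + real (CARD('j) + CARD('l)) * \<gamma> * (R * norm (w' - w))"
    by (simp add: svm_loss_def sum.distrib algebra_simps)
  finally show ?thesis .
qed

text \<open>
  The points of a cluster stand or fall together: their margins differ by at most \<open>2\<rho>\<parallel>w\<parallel>\<close>, so a
  single bad margin forces a loss of at least \<open>\<gamma>(1-\<theta>) - \<mu>\<gamma>\<^sup>2/2\<close> on every one of them.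
\<close>

lemma cluster_margin:
  assumes "0 < \<mu>" "0 \<le> \<gamma>"
    and ball: "\<And>i. i \<in> S \<Longrightarrow> p i \<in> cball z \<rho>"
    and card: "m \<le> real (card S)" "0 \<le> m"
    and loss: "(\<Sum>i\<in>S. psi \<mu> \<gamma> (p i \<bullet> w + t)) \<le> B"
    and B: "0 \<le> B" "B < m * (\<gamma> * (\<kappa> - 2 * \<rho> * norm w) - \<mu> / 2 * \<gamma>\<^sup>2)"
    and i: "i \<in> S"
  shows "p i \<bullet> w + t \<ge> 1 - \<kappa>"
proof (rule ccontr)
  assume bad: "\<not> p i \<bullet> w + t \<ge> 1 - \<kappa>"
  let ?b = "\<gamma> * (\<kappa> - 2 * \<rho> * norm w) - \<mu> / 2 * \<gamma>\<^sup>2"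
  have low: "?b \<le> psi \<mu> \<gamma> (p k \<bullet> w + t)" if k: "k \<in> S" for k
  proof -
    have "norm (p k - p i) \<le> 2 * \<rho>"
      using ball[OF k] ball[OF i] dist_triangle3[of "p k" "p i" z]
      by (simp add: dist_norm[symmetric])
    then have "norm (p k - p i) * norm w \<le> 2 * \<rho> * norm w"
      by (rule mult_right_mono) simp
    then have "p k \<bullet> w - p i \<bullet> w \<le> 2 * \<rho> * norm w"
      using norm_cauchy_schwarz[of "p k - p i" w] by (simp add: inner_diff_left)
    with bad have "\<kappa> - 2 * \<rho> * norm w \<le> 1 - (p k \<bullet> w + t)"
      by linarith
    then have "?b \<le> \<gamma> * (1 - (p k \<bullet> w + t)) - \<mu> / 2 * \<gamma>\<^sup>2"
      using assms(2) by (simp add: mult_left_mono)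
    also have "\<dots> \<le> psi \<mu> \<gamma> (p k \<bullet> w + t)"
      using assms(1,2) by (intro psi_ge) auto
    finally show ?thesis .
  qed
  have "0 < m * ?b"
    using B by linarith
  then have "0 \<le> ?b"
    using card(2) by (simp add: zero_less_mult_iff)
  with card(1) have "m * ?b \<le> real (card S) * ?b"
    by (rule mult_right_mono)
  also have "\<dots> \<le> (\<Sum>i\<in>S. psi \<mu> \<gamma> (p i \<bullet> w + t))"
    using low by (rule sum_bounded_below)
  finally show False
    using loss B(2) by linarith
qed

section \<open>The data model\<close>

lemma svm_data_model_norm_le:
  fixes c :: "'j::finite \<Rightarrow> real^'d" and d :: "'l::finite \<Rightarrow> real^'d"
  assumes "svm_data_model \<sigma>1 \<sigma>2 \<rho> \<nu> k c d J L"
  shows "norm (c i) \<le> 1 + \<rho>" and "norm (d i') \<le> 1 + \<rho>"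
proof -
  let ?e = "axis k 1 :: real^'d"
  have norm_le: "norm x \<le> \<bar>s\<bar> + r" if "x \<in> cball (s *\<^sub>R ?e) r" for x s r
    using that norm_triangle_ineq2[of x "s *\<^sub>R ?e"]
    by (simp add: dist_norm norm_minus_commute norm_axis_1)
  note M = assms[unfolded svm_data_model_def Let_def]
  show "norm (c i) \<le> 1 + \<rho>"
  proof (cases "i \<in> J")
    case True
    with M have "norm (c i) \<le> \<bar>\<sigma>1\<bar> + \<rho>"
      by (intro norm_le) blast
    with M show ?thesis
      by auto
  next
    case False
    with M have "norm (c i) \<le> \<bar>(\<sigma>1 - \<sigma>2) / 2\<bar> + ((\<sigma>1 + \<sigma>2) / 2 + \<rho>)"
      by (intro norm_le) blast
    with M show ?thesis
      by (auto simp: abs_if field_simps split: if_splits)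
  qed
  show "norm (d i') \<le> 1 + \<rho>"
  proof (cases "i' \<in> L")
    case True
    with M have "norm (d i') \<le> \<bar>- \<sigma>2\<bar> + \<rho>"
      by (intro norm_le) blast
    with M show ?thesis
      by auto
  next
    case False
    with M have "norm (d i') \<le> \<bar>(\<sigma>1 - \<sigma>2) / 2\<bar> + ((\<sigma>1 + \<sigma>2) / 2 + \<rho>)"
      by (intro norm_le) blast
    with M show ?thesis
      by (auto simp: abs_if field_simps split: if_splits)
  qed
qed

text \<open>
  Compare the optimum with the classifier \<open>w = (1+\<delta>)e\<^sub>1\<close>, \<open>t = 0\<close>, where \<open>1 + \<delta> = 1/(\<sigma>-\<rho>)\<close>. It
  gives the well-classified points margin at least 1, hence loss 0, and the noise points margin
  at least \<open>- 2(1+\<delta>)\<close>; so its objective value is at most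
  \<open>(1+\<delta>)\<^sup>2/2 + \<nu>(48 + 128(1+\<delta>)) = (1+\<xi>)\<^sup>2/2\<close>, the defining equation of \<open>\<xi>\<close>.
\<close>

lemma norm_primal_optimum_le:
  fixes c :: "'j::finite \<Rightarrow> real^'d" and d :: "'l::finite \<Rightarrow> real^'d"
  assumes n: "n = CARD('j) + CARD('l)" and \<gamma>: "\<gamma> = 64 / real n" and \<mu>: "\<mu> = real n / 128"
    and model: "svm_data_model \<sigma>1 \<sigma>2 \<rho> \<nu> k c d J L"
    and \<sigma>: "\<sigma> = min \<sigma>1 \<sigma>2" and \<xi>: "\<xi> = xi_const \<sigma> \<rho> \<nu>"
    and min: "\<And>w' t'. svm_f \<mu> \<gamma> c d w t \<le> svm_f \<mu> \<gamma> c d w' t'"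
  shows "norm w \<le> 1 + \<xi>"
proof -
  let ?e = "axis k 1 :: real^'d"
  note M = model[unfolded svm_data_model_def Let_def]
  have n0: "0 < real n"
    by (simp add: n add_pos_pos)
  have pos: "0 < \<mu>" "0 \<le> \<gamma>"
    using n0 by (auto simp: \<mu> \<gamma>)
  have n\<gamma>: "real n * \<gamma> = 64"
    using n0 by (simp add: \<gamma>)
  define D where "D = 1 / (\<sigma> - \<rho>)"
  have \<sigma>\<rho>: "0 < \<sigma> - \<rho>" and \<rho>: "0 < \<rho>" "\<rho> < 1" and \<nu>: "0 < \<nu>"
    using M by (auto simp: \<sigma>)
  have D: "0 < D" "(\<sigma> - \<rho>) * D = 1"
    using \<sigma>\<rho> by (auto simp: D_def)
  have e_le: "\<sigma> - \<rho> \<le> x \<bullet> ?e" if x: "x \<in> cball (s *\<^sub>R ?e) \<rho>" and "\<sigma> \<le> s" for x s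
  proof -
    have "(s *\<^sub>R ?e - x) \<bullet> ?e \<le> norm (s *\<^sub>R ?e - x) * norm ?e"
      by (rule norm_cauchy_schwarz)
    also have "\<dots> \<le> \<rho>"
      using x by (simp add: dist_norm norm_axis_1)
    finally have "s - x \<bullet> ?e \<le> \<rho>"
      by (simp add: inner_diff_left inner_axis_axis)
    then show ?thesis
      using that(2) by linarith
  qed
  have well: "1 \<le> x \<bullet> (D *\<^sub>R ?e)" if "\<sigma> - \<rho> \<le> x \<bullet> ?e" for x
    using mult_left_mono[OF that, of D] D
    by (metis inner_scaleR_right less_imp_le mult.commute)
  have cJ: "psi \<mu> \<gamma> (c i \<bullet> (D *\<^sub>R ?e) + 0) \<le> 0" if "i \<in> J" for i
  proof -
    have "\<sigma> - \<rho> \<le> c i \<bullet> ?e"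
      using M that by (intro e_le[of _ \<sigma>1]) (auto simp: \<sigma>)
    then show ?thesis
      using well psi_le_quadratic[OF pos, of 0] by force
  qed
  have dL: "psi \<mu> \<gamma> (- (d i \<bullet> (D *\<^sub>R ?e)) - 0) \<le> 0" if "i \<in> L" for i
  proof -
    have "d i \<in> cball (- \<sigma>2 *\<^sub>R ?e) \<rho>"
      using M that by blast
    then have "- d i \<in> cball (\<sigma>2 *\<^sub>R ?e) \<rho>"
      by (simp add: dist_norm norm_minus_commute add.commute)
    then have "\<sigma> - \<rho> \<le> (- d i) \<bullet> ?e"
      by (rule e_le) (simp add: \<sigma>)
    then show ?thesis
      using well[of "- d i"] psi_le_quadratic[OF pos, of 0] by force
  qed
  have noise: "psi \<mu> \<gamma> \<theta> \<le> \<gamma> * (3/4 + 2 * D)" if "\<bar>\<theta>\<bar> \<le> 2 * D" for \<theta>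
  proof -
    have "psi \<mu> \<gamma> 0 = \<gamma> * (3/4)"
      using n0 by (simp add: psi_def \<mu> \<gamma> field_simps power2_eq_square)
    moreover have "\<gamma> * \<bar>\<theta>\<bar> \<le> \<gamma> * (2 * D)"
      using that pos by (intro mult_left_mono)
    ultimately show ?thesis
      using psi_lipschitz[OF pos, of \<theta> 0] by (simp add: algebra_simps)
  qed
  have inner_le: "\<bar>x \<bullet> (D *\<^sub>R ?e)\<bar> \<le> 2 * D" if "norm x \<le> 1 + \<rho>" for x
  proof -
    have "\<bar>x \<bullet> (D *\<^sub>R ?e)\<bar> \<le> norm x * norm (D *\<^sub>R ?e)"
      by (rule Cauchy_Schwarz_ineq2)
    also have "\<dots> \<le> 2 * D"
      using that \<rho> D by (simp add: norm_axis_1)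
    finally show ?thesis .
  qed
  have "svm_loss \<mu> \<gamma> c d (D *\<^sub>R ?e) 0 \<le> real n * (0 + \<nu> * (\<gamma> * (3/4 + 2 * D)))"
  proof (rule svm_loss_le_split)
    show "real n = real (CARD('j) + CARD('l))"
      by (simp add: n)
    show "real n - real (card J) - real (card L) \<le> \<nu> * real n"
      using M by (simp add: n)
    show "0 \<le> \<gamma> * (3/4 + 2 * D)"
      using D pos by simp
    show "psi \<mu> \<gamma> (c i \<bullet> (D *\<^sub>R ?e) + 0) \<le> \<gamma> * (3/4 + 2 * D)" for i
      using inner_le[OF svm_data_model_norm_le(1)[OF model]] by (intro noise) simp
    show "psi \<mu> \<gamma> (- (d i \<bullet> (D *\<^sub>R ?e)) - 0) \<le> \<gamma> * (3/4 + 2 * D)" for i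
      using inner_le[OF svm_data_model_norm_le(2)[OF model]] by (intro noise) simp
  qed (use cJ dL in auto)
  also have "\<dots> = (real n * \<gamma>) * (\<nu> * (3/4 + 2 * D))"
    by (simp only: mult_ac add_0)
  also have "\<dots> = \<nu> * (48 + 128 * D)"
    unfolding n\<gamma> by (simp add: algebra_simps)
  finally have loss0: "svm_loss \<mu> \<gamma> c d (D *\<^sub>R ?e) 0 \<le> \<nu> * (48 + 128 * D)" .
  have "0 \<le> svm_loss \<mu> \<gamma> c d w t"
    unfolding svm_loss_def by (intro add_nonneg_nonneg sum_nonneg psi_nonneg pos)
  then have "1/2 * (norm w)\<^sup>2 \<le> svm_f \<mu> \<gamma> c d w t"
    by (simp add: svm_f_eq_loss)
  also have "\<dots> \<le> svm_f \<mu> \<gamma> c d (D *\<^sub>R ?e) 0"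
    by (rule min)
  also have "\<dots> \<le> 1/2 * D\<^sup>2 + \<nu> * (48 + 128 * D)"
    using loss0 by (simp add: svm_f_eq_loss norm_axis_1 power_mult_distrib)
  finally have "(norm w)\<^sup>2 \<le> D\<^sup>2 + 32 * \<nu> * (3 + 8 * D)"
    by (simp add: algebra_simps)
  then have "norm w \<le> sqrt (D\<^sup>2 + 32 * \<nu> * (3 + 8 * D))"
    by (rule real_le_rsqrt)
  also have "\<dots> = 1 + \<xi>"
    by (simp add: \<xi> xi_const_def delta_const_def D_def[symmetric] algebra_simps)
  finally show ?thesis .
qed

section \<open>Approximate dual solutions separate the well-classified points\<close>

theorem theorem3p5:
  fixes c :: "'j::finite \<Rightarrow> real^'d" and d :: "'l::finite \<Rightarrow> real^'d"
    and J :: "'j set" and L :: "'l set" and k :: 'd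
    and \<sigma>1 \<sigma>2 \<sigma> \<rho> \<nu> \<gamma> \<mu> \<xi> K Kbar ts tk :: real and n :: nat
    and us uk :: "real^'j" and vs vk :: "real^'l" and ws wk :: "real^'d"
  assumes "n = CARD('j) + CARD('l)" and "\<gamma> = 64 / real n" and "\<mu> = real n / 128"
    and "svm_data_model \<sigma>1 \<sigma>2 \<rho> \<nu> k c d J L"
    and "\<sigma> = min \<sigma>1 \<sigma>2" and "\<xi> = xi_const \<sigma> \<rho> \<nu>"
    and "(1 + \<xi> + 64 * \<nu>) / (\<sigma> - \<rho>) \<le> 64 / 3"
    and "is_arg_max (\<lambda>(u, v). svm_dual_objective \<mu> c d u v) (\<lambda>p. p \<in> svm_Omega \<gamma>) (us, vs)"
    and "is_arg_min (\<lambda>(w, t). svm_f \<mu> \<gamma> c d w t) (\<lambda>_. True) (ws, ts)"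
    and "K = K_const \<sigma> \<rho> \<nu>" and "0 \<le> K" and "K < 1/2"
    and "\<forall>i\<in>J. c i \<bullet> ws + ts \<ge> 1 - K"
    and "\<forall>i\<in>L. - (d i \<bullet> ws) - ts \<ge> 1 - K"
    and "1/2 \<le> Kbar" and "Kbar < 1"
    and "Kbar - 3 * K\<^sup>2 > 3 * \<rho> * (1 + \<xi>) * (4/3 + 2 * \<nu>) + 3 * \<nu> * (9/4 + 2 * \<xi>) + 1/2"
    and "norm ((uk, vk) - (us, vs)) \<le> Delta_const n \<rho> \<nu> \<xi> K Kbar"
    and "wk = svm_w c d uk vk"
    and "is_arg_min (\<lambda>t. svm_f \<mu> \<gamma> c d wk t) (\<lambda>_. True) tk"
  shows "separating_hyperplane wk tk (c ` J) (d ` L) \<and>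
    (\<forall>i\<in>J. c i \<bullet> wk + tk \<ge> 1 - Kbar) \<and> (\<forall>i\<in>L. d i \<bullet> wk + tk \<le> -1 + Kbar)"
proof -
  note model = assms(4)
  note M = model[unfolded svm_data_model_def Let_def]
  have n: "real n = real (CARD('j) + CARD('l))"
    by (simp add: assms(1))
  have n0: "0 < real n"
    by (simp add: assms(1) add_pos_pos)
  have pos: "0 < \<mu>" "0 \<le> \<gamma>" and n\<gamma>: "real n * \<gamma> = 64" and \<mu>\<gamma>: "1 / (2 * \<mu>) = \<gamma>"
    using n0 by (auto simp: assms(2,3))
  have \<rho>: "0 < \<rho>" "\<rho> < 1" and \<nu>: "0 < \<nu>"
    using M by auto
  note norm_c = svm_data_model_norm_le(1)[OF model] and norm_d = svm_data_model_norm_le(2)[OF model]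
  have min: "svm_f \<mu> \<gamma> c d ws ts \<le> svm_f \<mu> \<gamma> c d w' t'" for w' t'
    using assms(9) by (auto simp: is_arg_min_def not_less)
  have ws_le: "norm ws \<le> 1 + \<xi>"
    using norm_primal_optimum_le[OF assms(1-6) min] .
  then have \<xi>: "0 \<le> 1 + \<xi>"
    using norm_ge_zero order_trans by blast
  have ws: "ws = svm_w c d us vs"
    using primal_optimum_eq_dual[OF pos assms(8,9)] .

  (* The numerator of Delta; positive by the assumption on Kbar. *)
  define num where "num = 1/3 * (Kbar - 3 * K\<^sup>2) - \<rho> * (1 + \<xi>) * (4/3 + 2 * \<nu>)
    - \<nu> * (9/4 + 2 * \<xi>) - 1/6"
  have num: "0 < num"
    using assms(17) by (simp add: num_def field_simps)
  define \<epsilon> where "\<epsilon> = norm (wk - ws)"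
  have \<epsilon>: "0 \<le> \<epsilon>"
    by (simp add: \<epsilon>_def)
  have "\<epsilon> * (4 * (1 + 2/3 * \<rho>)) \<le> (1 + \<rho>) * num"
  proof -
    have "\<epsilon> = norm (svm_w c d (uk - us) (vk - vs))"
      by (simp add: \<epsilon>_def ws assms(19) svm_w_diff)
    also have "\<dots> \<le> (1 + \<rho>) * (sqrt (real n) * norm (uk - us, vk - vs))"
      unfolding n by (rule norm_svm_w_le[OF norm_c norm_d])
    also have "\<dots> \<le> (1 + \<rho>) * (sqrt (real n) * Delta_const n \<rho> \<nu> \<xi> K Kbar)"
      using assms(18) \<rho> by (intro mult_left_mono) auto
    also have "sqrt (real n) * Delta_const n \<rho> \<nu> \<xi> K Kbar = num / (sqrt 2 * (4 * (1 + 2/3 * \<rho>)))"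
      unfolding Delta_const_def num_def[symmetric]
      using n0 \<rho> by (simp add: real_sqrt_mult)
    finally have "\<epsilon> * (sqrt 2 * (4 * (1 + 2/3 * \<rho>))) \<le> (1 + \<rho>) * num"
      using \<rho> by (simp add: pos_le_divide_eq)
    moreover have "1 * (4 * (1 + 2/3 * \<rho>)) \<le> sqrt 2 * (4 * (1 + 2/3 * \<rho>))"
      using \<rho> by (intro mult_right_mono) auto
    then have "\<epsilon> * (1 * (4 * (1 + 2/3 * \<rho>))) \<le> \<epsilon> * (sqrt 2 * (4 * (1 + 2/3 * \<rho>)))"
      using \<epsilon> by (rule mult_left_mono)
    ultimately show ?thesis
      by simp
  qed
  (* In units of 64, a perturbation \<epsilon> of w costs (1 + \<rho>) * \<epsilon> by the Lipschitz bound on the loss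
     and 2/3 * \<rho> * \<epsilon> through the spread of the margins in a cluster. *)
  have \<epsilon>_num: "(1 + 5/3 * \<rho>) * \<epsilon> \<le> num"
  proof -
    let ?q = "4 * (1 + 2/3 * \<rho>)"
    have q: "0 < ?q"
      using \<rho> by simp
    have "\<rho>\<^sup>2 \<le> 1"
      using \<rho> by (simp add: power_le_one)
    then have coeff: "(1 + 5/3 * \<rho>) * (1 + \<rho>) \<le> ?q"
      by (simp add: field_simps power2_eq_square)
    have "(1 + 5/3 * \<rho>) * \<epsilon> * ?q \<le> (1 + 5/3 * \<rho>) * ((1 + \<rho>) * num)"
      using \<open>\<epsilon> * ?q \<le> (1 + \<rho>) * num\<close> \<rho> by (simp only: mult.assoc) (intro mult_left_mono, auto)
    also have "\<dots> \<le> ?q * num"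
      using mult_right_mono[OF coeff, of num] num by (simp only: mult.assoc)
    finally have "(1 + 5/3 * \<rho>) * \<epsilon> * ?q \<le> num * ?q"
      by (simp only: mult.commute)
    then show ?thesis
      using q by (rule mult_right_le_imp_le)
  qed

  have "0 < real (card J)" "0 < real (card L)"
    using M n0 by (auto simp: assms(1))
  then obtain i0 l0 where i0: "i0 \<in> J" and l0: "l0 \<in> L"
    by (metis card_gt_0_iff ex_in_conv of_nat_0_less_iff)
  have inner_ws: "\<bar>x \<bullet> ws\<bar> \<le> (1 + \<rho>) * (1 + \<xi>)" if "norm x \<le> 1 + \<rho>" for x
  proof -
    have "\<bar>x \<bullet> ws\<bar> \<le> norm x * norm ws"
      by (rule Cauchy_Schwarz_ineq2)
    also have "\<dots> \<le> (1 + \<rho>) * (1 + \<xi>)"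
      using that ws_le \<rho> by (intro mult_mono) auto
    finally show ?thesis .
  qed
  have ts: "\<bar>ts\<bar> \<le> (1 + \<rho>) * (1 + \<xi>) - 1/2"
    using bspec[OF assms(13) i0] bspec[OF assms(14) l0] inner_ws[OF norm_c[of i0]]
      inner_ws[OF norm_d[of l0]] assms(12) by linarith

  define H where "H = 1/4 + 2 * ((1 + \<rho>) * (1 + \<xi>))"
  have H: "0 \<le> H"
    using \<rho> \<xi> by (simp add: H_def)
  have noise: "psi \<mu> \<gamma> \<theta> \<le> \<gamma> * H" if "\<bar>\<theta>\<bar> \<le> 2 * ((1 + \<rho>) * (1 + \<xi>)) - 1/2" for \<theta>
  proof -
    have "psi \<mu> \<gamma> 0 = \<gamma> * (3/4)"
      using n0 by (simp add: psi_def assms(2,3) field_simps power2_eq_square)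
    then have "psi \<mu> \<gamma> \<theta> \<le> \<gamma> * (3/4 + \<bar>\<theta>\<bar>)"
      using psi_lipschitz[OF pos, of \<theta> 0] by (simp add: algebra_simps)
    also have "\<dots> \<le> \<gamma> * H"
      using that pos by (intro mult_left_mono) (auto simp: H_def)
    finally show ?thesis .
  qed
  have well: "psi \<mu> \<gamma> \<theta> \<le> \<gamma> * K\<^sup>2" if "1 - K \<le> \<theta>" for \<theta>
    using psi_le_quadratic[OF pos assms(11) that] \<mu>\<gamma> by (metis times_divide_eq_left mult_1)
  have loss_ws: "svm_loss \<mu> \<gamma> c d ws ts \<le> real n * (\<gamma> * K\<^sup>2 + \<nu> * (\<gamma> * H))"
  proof (rule svm_loss_le_split[OF n])
    show "real n - real (card J) - real (card L) \<le> \<nu> * real n"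
      using M by (simp add: n)
    show "0 \<le> \<gamma> * K\<^sup>2" "0 \<le> \<gamma> * H"
      using pos H by auto
    show "psi \<mu> \<gamma> (c i \<bullet> ws + ts) \<le> \<gamma> * K\<^sup>2" if "i \<in> J" for i
      using assms(13) that by (intro well) auto
    show "psi \<mu> \<gamma> (- (d i \<bullet> ws) - ts) \<le> \<gamma> * K\<^sup>2" if "i \<in> L" for i
      using assms(14) that by (intro well) auto
    show "psi \<mu> \<gamma> (c i \<bullet> ws + ts) \<le> \<gamma> * H" for i
      using inner_ws[OF norm_c[of i]] ts by (intro noise) linarith
    show "psi \<mu> \<gamma> (- (d i \<bullet> ws) - ts) \<le> \<gamma> * H" for i
      using inner_ws[OF norm_d[of i]] ts by (intro noise) linarith
  qed
  define B where "B = 64 * (K\<^sup>2 + \<nu> * H + (1 + \<rho>) * \<epsilon>)"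
  have B: "0 \<le> B"
    using \<rho> \<nu> H \<epsilon> by (simp add: B_def)
  have loss_wk: "svm_loss \<mu> \<gamma> c d wk tk \<le> B"
  proof -
    have "svm_f \<mu> \<gamma> c d wk tk \<le> svm_f \<mu> \<gamma> c d wk ts"
      using assms(20) by (auto simp: is_arg_min_def not_less)
    then have "svm_loss \<mu> \<gamma> c d wk tk \<le> svm_loss \<mu> \<gamma> c d wk ts"
      by (simp add: svm_f_eq_loss)
    also have "\<dots> \<le> svm_loss \<mu> \<gamma> c d ws ts + real n * \<gamma> * ((1 + \<rho>) * \<epsilon>)"
      unfolding n \<epsilon>_def by (rule svm_loss_lipschitz[OF pos norm_c norm_d])
    also have "\<dots> \<le> real n * (\<gamma> * K\<^sup>2 + \<nu> * (\<gamma> * H)) + real n * \<gamma> * ((1 + \<rho>) * \<epsilon>)"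
      using loss_ws by simp
    also have "\<dots> = (real n * \<gamma>) * (K\<^sup>2 + \<nu> * H + (1 + \<rho>) * \<epsilon>)"
      by (simp only: distrib_left mult_ac)
    finally show ?thesis
      unfolding n\<gamma> B_def .
  qed
  have B_less: "B < real n / 3 * (\<gamma> * (Kbar - 2 * \<rho> * norm wk) - \<mu> / 2 * \<gamma>\<^sup>2)"
  proof -
    have "norm wk \<le> 1 + \<xi> + \<epsilon>"
      using norm_triangle_sub[of wk ws] ws_le by (simp add: \<epsilon>_def)
    then have "\<rho> * norm wk \<le> \<rho> * (1 + \<xi> + \<epsilon>)"
      using \<rho> by (intro mult_left_mono) auto
    moreover have "0 \<le> \<rho> * (1 + \<xi>)"
      using \<rho> \<xi> by simp
    ultimately have "B < 64/3 * (Kbar - 2 * (\<rho> * norm wk) - 1/4)"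
      using \<epsilon>_num unfolding B_def H_def num_def by (simp add: field_simps)
    also have "\<dots> = real n / 3 * (\<gamma> * (Kbar - 2 * \<rho> * norm wk) - \<mu> / 2 * \<gamma>\<^sup>2)"
      using n0 by (simp add: assms(2,3) field_simps power2_eq_square)
    finally show ?thesis .
  qed

  have marginJ: "c i \<bullet> wk + tk \<ge> 1 - Kbar" if "i \<in> J" for i
  proof (rule cluster_margin[OF pos _ _ _ _ B B_less that])
    show "c i \<in> cball (\<sigma>1 *\<^sub>R axis k 1) \<rho>" if "i \<in> J" for i
      using M that by blast
    show "real n / 3 \<le> real (card J)"
      using M by (simp add: assms(1))
    have "(\<Sum>i\<in>J. psi \<mu> \<gamma> (c i \<bullet> wk + tk)) \<le> (\<Sum>i\<in>UNIV. psi \<mu> \<gamma> (c i \<bullet> wk + tk))"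
      by (intro sum_mono2) (auto intro: psi_nonneg pos)
    also have "\<dots> \<le> svm_loss \<mu> \<gamma> c d wk tk"
      unfolding svm_loss_def by (simp add: sum_nonneg psi_nonneg pos)
    finally show "(\<Sum>i\<in>J. psi \<mu> \<gamma> (c i \<bullet> wk + tk)) \<le> B"
      using loss_wk by linarith
  qed simp
  (* The other class by reflection: its points -d i have margins with offset -tk. *)
  have "(- d i) \<bullet> wk + - tk \<ge> 1 - Kbar" if "i \<in> L" for i
  proof (rule cluster_margin[OF pos _ _ _ _ B B_less that])
    show "- d i \<in> cball (\<sigma>2 *\<^sub>R axis k 1) \<rho>" if "i \<in> L" for i
    proof -
      have "d i \<in> cball (- \<sigma>2 *\<^sub>R axis k 1) \<rho>"
        using M that by blast
      then show ?thesis
        by (simp add: dist_norm norm_minus_commute add.commute)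
    qed
    show "real n / 3 \<le> real (card L)"
      using M by (simp add: assms(1))
    have "(\<Sum>i\<in>L. psi \<mu> \<gamma> (- d i \<bullet> wk + - tk)) \<le> (\<Sum>i\<in>UNIV. psi \<mu> \<gamma> (- d i \<bullet> wk + - tk))"
      by (intro sum_mono2) (auto intro: psi_nonneg pos)
    also have "\<dots> \<le> svm_loss \<mu> \<gamma> c d wk tk"
      unfolding svm_loss_def by (simp add: sum_nonneg psi_nonneg pos)
    finally show "(\<Sum>i\<in>L. psi \<mu> \<gamma> (- d i \<bullet> wk + - tk)) \<le> B"
      using loss_wk by linarith
  qed simp
  then have marginL: "d i \<bullet> wk + tk \<le> -1 + Kbar" if "i \<in> L" for i
    using that by force
  have "wk \<noteq> 0"
    using marginJ[OF i0] marginL[OF l0] assms(16) by auto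
  then show ?thesis
    using marginJ marginL assms(16) unfolding separating_hyperplane_def by fastforce
qed

end
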